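(* Let $k\ge 1$ and let $A_1,\dots,A_k$ be sets, let $A=\bigcup_{i=1}^k A_i$, and let $w:A\to\mathbb{R}$ be injective. Let $\rho$ and $\sigma$ be the maps defined by Algorithms A and B described in the context. Then $\rho$ and $\sigma$ are bijections between $\mathcal{P}(A_1,\dots,A_k)$ and $\mathcal{Q}(A_1,\dots,A_k)$.
   Context: $N_k=\{1,2,\dots,k\}$ and $\mathbb{N}_0$ is the set of non-negative integers. For sets $A_j$, $j\in I$, let $\bigvee_{j\in I}A_j$ denote the set of elements belonging to exactly one of the sets $A_j$, $j\in I$, i.e. $\bigvee_{j\in I}A_j=\bigcup_{j\in I}\bigl(A_j-\bigcup_{l\in I,\,l\ne j}A_l\bigr)$. A mapping $f:\{A_i:i\in N_k\}\to\mathbb{N}_0$ is an S-parking function of $A_1,\dots,A_k$ if for every non-empty $I\subseteq N_k$ there exists $i\in I$ with $|A_i\cap\bigvee_{j\in I}A_j|>f(A_i)$; this inequality holds automatically if the intersection is infinite. $\mathcal{P}(A_1,\dots,A_k)$ denotes the set of S-parking functions. A $k$-element set $D$ is an S-parking set of $A_1,\dots,A_k$ if $D\cap\bigvee_{j\in I}A_j\neq\emptyset$ for every non-empty $I\subseteq N_k$. $\mathcal{Q}(A_1,\dots,A_k)$ denotes the set of S-parking sets. Algorithm A takes as input $D\in\mathcal{Q}(A_1,\dots,A_k)$. - Initialize $I:=N_k$, and for all $j$ set $f(A_j):=0$ and $F_j:=A_j$. - While $I\neq\emptyset$: let $e$ be the element of $\bigvee_{j\in I}F_j$ of minimum weight $w(e)$,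 and let $s\in I$ be the unique index with $e\in F_s$. - If $e\notin D$, set $F_s:=F_s-\{e\}$ and $f(A_s):=f(A_s)+1$. - Otherwise, set $I:=I-\{s\}$. - Output $f$, and define $\rho(D):=f$. This defines a map $\rho$ from $\mathcal{Q}(A_1,\dots,A_k)$ to $\mathcal{P}(A_1,\dots,A_k)$. Algorithm B takes as input $f\in\mathcal{P}(A_1,\dots,A_k)$. - Initialize $I:=N_k$, and for all $j$ set $g(A_j):=f(A_j)$ and $F_j:=A_j$. - While $I\neq\emptyset$: let $e$ be the element of $\bigvee_{j\in I}F_j$ of minimum weight, and let $s\in I$ be the unique index with $e\in F_s$. - If $g(A_s)>0$, set $F_s:=F_s-\{e\}$ and $g(A_s):=g(A_s)-1$. - Otherwise, record $e$ and set $I:=I-\{s\}$. - Output the set $D$ of the $k$ recorded elements, and define $\sigma(f):=D$. This defines a map $\sigma$ from $\mathcal{P}(A_1,\dots,A_k)$ to $\mathcal{Q}(A_1,\dots,A_k)$.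
   Formalization: For infinite sets the algorithms may lack a minimum or never stop (e.g. A_1 = Z, w = id), so it is assumed that each element of A has finitely many elements of smaller weight (automatic for finite A) or else that both algorithms produce an output on every input. *)

theory Defs
  imports Complex_Main "HOL-Library.FuncSet"
begin

definition exactly_one :: "nat set \<Rightarrow> (nat \<Rightarrow> 'a set) \<Rightarrow> 'a set" where
  "exactly_one I F = (\<Union>j\<in>I. F j - (\<Union>l\<in>I - {j}. F l))"

text \<open>As in the source, an S-parking function is a function on the collection of sets
  \<open>{A 1, \<dots>, A k}\<close>, not on the indices. It is made extensional so that its values
  elsewhere do not matter.\<close>

definition S_parking_functions :: "nat \<Rightarrow> (nat \<Rightarrow> 'a set) \<Rightarrow> ('a set \<Rightarrow> nat) set" where
  "S_parking_functions k A =
    {f \<in> A ` {1..k} \<rightarrow>\<^sub>E UNIV.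
       \<forall>I. I \<subseteq> {1..k} \<and> I \<noteq> {} \<longrightarrow>
         (\<exists>i\<in>I. infinite (A i \<inter> exactly_one I A) \<or> card (A i \<inter> exactly_one I A) > f (A i))}"

definition S_parking_sets :: "nat \<Rightarrow> (nat \<Rightarrow> 'a set) \<Rightarrow> 'a set set" where
  "S_parking_sets k A =
    {D. finite D \<and> card D = k \<and>
        (\<forall>I. I \<subseteq> {1..k} \<and> I \<noteq> {} \<longrightarrow> D \<inter> exactly_one I A \<noteq> {})}"

text \<open>One iteration of the loop of Algorithm A on states \<open>(I, F, f)\<close>. If there is no element of
  minimum weight, the state has no successor, so the algorithm is stuck and yields no output.\<close>

inductive algA_step ::
  "('a \<Rightarrow> real) \<Rightarrow> (nat \<Rightarrow> 'a set) \<Rightarrow> 'a set \<Rightarrow>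
   nat set \<times> (nat \<Rightarrow> 'a set) \<times> ('a set \<Rightarrow> nat) \<Rightarrow>
   nat set \<times> (nat \<Rightarrow> 'a set) \<times> ('a set \<Rightarrow> nat) \<Rightarrow> bool"
  for w :: "'a \<Rightarrow> real" and A :: "nat \<Rightarrow> 'a set" and D :: "'a set" where
  discard: "\<lbrakk>is_arg_min w (\<lambda>x. x \<in> exactly_one I F) e; s \<in> I; e \<in> F s; e \<notin> D\<rbrakk> \<Longrightarrow>
    algA_step w A D (I, F, f) (I, F(s := F s - {e}), f(A s := f (A s) + 1))"
| select: "\<lbrakk>is_arg_min w (\<lambda>x. x \<in> exactly_one I F) e; s \<in> I; e \<in> F s; e \<in> D\<rbrakk> \<Longrightarrow>
    algA_step w A D (I, F, f) (I - {s}, F, f)"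

definition algA_output ::
  "('a \<Rightarrow> real) \<Rightarrow> nat \<Rightarrow> (nat \<Rightarrow> 'a set) \<Rightarrow> 'a set \<Rightarrow> ('a set \<Rightarrow> nat) \<Rightarrow> bool" where
  "algA_output w k A D f \<longleftrightarrow>
    (\<exists>F. (algA_step w A D)\<^sup>*\<^sup>* ({1..k}, A, restrict (\<lambda>_. 0) (A ` {1..k})) ({}, F, f))"

definition rho :: "('a \<Rightarrow> real) \<Rightarrow> nat \<Rightarrow> (nat \<Rightarrow> 'a set) \<Rightarrow> 'a set \<Rightarrow> ('a set \<Rightarrow> nat)" where
  "rho w k A D = (THE f. algA_output w k A D f)"

text \<open>Algorithm B, on states \<open>(I, F, g, R)\<close>, where \<open>R\<close> is the set of elements recorded so far.\<close>

inductive algB_step ::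
  "('a \<Rightarrow> real) \<Rightarrow> (nat \<Rightarrow> 'a set) \<Rightarrow>
   nat set \<times> (nat \<Rightarrow> 'a set) \<times> ('a set \<Rightarrow> nat) \<times> 'a set \<Rightarrow>
   nat set \<times> (nat \<Rightarrow> 'a set) \<times> ('a set \<Rightarrow> nat) \<times> 'a set \<Rightarrow> bool"
  for w :: "'a \<Rightarrow> real" and A :: "nat \<Rightarrow> 'a set" where
  discard: "\<lbrakk>is_arg_min w (\<lambda>x. x \<in> exactly_one I F) e; s \<in> I; e \<in> F s; g (A s) > 0\<rbrakk> \<Longrightarrow>
    algB_step w A (I, F, g, R) (I, F(s := F s - {e}), g(A s := g (A s) - 1), R)"
| keep: "\<lbrakk>is_arg_min w (\<lambda>x. x \<in> exactly_one I F) e; s \<in> I; e \<in> F s; \<not> g (A s) > 0\<rbrakk> \<Longrightarrow>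
    algB_step w A (I, F, g, R) (I - {s}, F, g, insert e R)"

definition algB_output ::
  "('a \<Rightarrow> real) \<Rightarrow> nat \<Rightarrow> (nat \<Rightarrow> 'a set) \<Rightarrow> ('a set \<Rightarrow> nat) \<Rightarrow> 'a set \<Rightarrow> bool" where
  "algB_output w k A f D \<longleftrightarrow>
    (\<exists>F g. (algB_step w A)\<^sup>*\<^sup>* ({1..k}, A, f, {}) ({}, F, g, D))"

definition sigma :: "('a \<Rightarrow> real) \<Rightarrow> nat \<Rightarrow> (nat \<Rightarrow> 'a set) \<Rightarrow> ('a set \<Rightarrow> nat) \<Rightarrow> 'a set" where
  "sigma w k A f = (THE D. algB_output w k A f D)"

text \<open>For infinite sets and arbitrary injective weights, the algorithms need not define maps: a
  minimum may fail to exist (e.g. the integers with \<open>w x = x\<close>), or a run may be infinite.\<close>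

definition algorithms_define_maps :: "('a \<Rightarrow> real) \<Rightarrow> nat \<Rightarrow> (nat \<Rightarrow> 'a set) \<Rightarrow> bool" where
  "algorithms_define_maps w k A \<longleftrightarrow>
    (\<forall>D \<in> S_parking_sets k A. \<exists>f. algA_output w k A D f) \<and>
    (\<forall>f \<in> S_parking_functions k A. \<exists>D. algB_output w k A f D)"

end

theory Submission
  imports Defs
begin

text \<open>
  Forget the test that decides between discarding and selecting the current element, and keep track
  of both the discard counts \<open>f\<close> and the set \<open>D\<close> of selected elements. Along any run with
  arbitrary decisions, an element discarded from \<open>F j\<close> lies in no \<open>A i\<close> with \<open>i \<noteq> j\<close> still
  active. Hence, when the first index \<open>s\<close> of a set \<open>J\<close> becomes inactive, the selected element
  and all elements discarded from \<open>A s\<close> belong to exactly one of the \<open>A j\<close>, \<open>j \<in> J\<close>. So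
  every complete run ends with an S-parking set \<open>D\<close> and an S-parking function \<open>f\<close>; moreover it is
  at the same time the run of Algorithm A on \<open>D\<close> and the run of Algorithm B on \<open>f\<close>. Therefore
  the two maps are mutually inverse.
\<close>

section \<open>Runs of transition relations and elements of minimum weight\<close>

lemmas rtranclp_induct3 =
  rtranclp_induct[of _ "(ax, ay, az)" "(bx, by, bz)", split_rule, consumes 1, case_names refl step]

lemmas rtranclp_induct4 =
  rtranclp_induct[of _ "(ax, ay, az, aw)" "(bx, by, bz, bw)", split_rule,
    consumes 1, case_names refl step]

lemmas converse_rtranclp_induct4 =
  converse_rtranclp_induct[of _ "(ax, ay, az, aw)" "(bx, by, bz, bw)", split_rule,
    consumes 1, case_names refl step]

text \<open>Follows the first run: under the invariant \<open>P\<close> the second run must take the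
  same step, until a state without successors is reached. This will justify the \<open>THE\<close>
  in \<open>rho\<close> and \<open>sigma\<close>.\<close>

lemma rtranclp_terminal_unique:
  assumes "r\<^sup>*\<^sup>* x y" "r\<^sup>*\<^sup>* x z" "P x"
    and "\<And>a b. P a \<Longrightarrow> r a b \<Longrightarrow> P b"
    and "\<And>a b c. P a \<Longrightarrow> r a b \<Longrightarrow> r a c \<Longrightarrow> b = c"
    and "\<And>a. \<not> r y a" "\<And>a. \<not> r z a"
  shows "y = z"
  using assms(1-3)
proof (induction rule: converse_rtranclp_induct)
  case base
  then show ?case using assms(6) by (metis converse_rtranclpE)
next
  case (step a b)
  from step.prems(1) show ?case
  proof (cases rule: converse_rtranclpE)
    case base
    then show ?thesis using step.hyps assms(7) by blast
  next
    case (step c)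
    then have "c = b"
      using assms(5) \<open>P a\<close> \<open>r a b\<close> by blast
    then show ?thesis
      using step \<open>P a\<close> \<open>r a b\<close> assms(4) step.IH by blast
  qed
qed

text \<open>Covers both ways an algorithm can fail: being stuck, excluded by the existence of
  \<open>b\<close>, and running forever, excluded by the decrease of \<open>m\<close>. It is later
  applied with reachability from the initial state as \<open>P\<close>.\<close>

lemma rtranclp_reaches_terminal:
  fixes m :: "'s \<Rightarrow> nat"
  assumes "P x"
    and "\<And>a. P a \<Longrightarrow> \<not> T a \<Longrightarrow> \<exists>b. r a b \<and> P b \<and> m b < m a"
  shows "\<exists>y. r\<^sup>*\<^sup>* x y \<and> T y"
  using assms(1)
proof (induction x rule: measure_induct_rule[of m])
  case (less x)
  show ?case
  proof (cases "T x")
    case False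
    then obtain b where "r x b" "P b" "m b < m x"
      using assms(2) less.prems by blast
    then show ?thesis
      using less.IH by (meson converse_rtranclp_into_rtranclp)
  qed blast
qed

lemma exactly_one_iff:
  "e \<in> exactly_one I F \<longleftrightarrow> (\<exists>s\<in>I. e \<in> F s \<and> (\<forall>j\<in>I. e \<in> F j \<longrightarrow> j = s))"
  unfolding exactly_one_def by blast

text \<open>A minimizer over the finite set of elements weighing at most \<open>w x\<close> is a
  minimizer over all of \<open>X\<close>, since everything else weighs more than
  \<open>x\<close>.\<close>

lemma is_arg_min_ex_below:
  fixes w :: "'a \<Rightarrow> real"
  assumes "x \<in> X" "finite {y \<in> X. w y \<le> w x}"
  obtains e where "is_arg_min w (\<lambda>y. y \<in> X) e" "w e \<le> w x"
proof -
  obtain e where "is_arg_min w (\<lambda>y. y \<in> {y \<in> X. w y \<le> w x}) e"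
    using ex_is_arg_min_if_finite[of "{y \<in> X. w y \<le> w x}" w] assms by auto
  then show ?thesis
    by (intro that[of e]) (auto simp: is_arg_min_def not_less, meson linear order_trans)
qed

text \<open>One iteration with an arbitrary decision, on states \<open>(I, F, f, R)\<close>, where \<open>f\<close> counts
  discarded elements and \<open>R\<close> collects selected ones.\<close>

inductive free_step ::
  "('a \<Rightarrow> real) \<Rightarrow> (nat \<Rightarrow> 'a set) \<Rightarrow>
   nat set \<times> (nat \<Rightarrow> 'a set) \<times> ('a set \<Rightarrow> nat) \<times> 'a set \<Rightarrow>
   nat set \<times> (nat \<Rightarrow> 'a set) \<times> ('a set \<Rightarrow> nat) \<times> 'a set \<Rightarrow> bool"
  for w :: "'a \<Rightarrow> real" and A :: "nat \<Rightarrow> 'a set" where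
  free_discard: "\<lbrakk>is_arg_min w (\<lambda>x. x \<in> exactly_one I F) e; s \<in> I; e \<in> F s\<rbrakk> \<Longrightarrow>
    free_step w A (I, F, f, R) (I, F(s := F s - {e}), f(A s := f (A s) + 1), R)"
| free_select: "\<lbrakk>is_arg_min w (\<lambda>x. x \<in> exactly_one I F) e; s \<in> I; e \<in> F s\<rbrakk> \<Longrightarrow>
    free_step w A (I, F, f, R) (I - {s}, F, f, insert e R)"

text \<open>Injectivity of \<open>A\<close> makes counts stored under the sets \<open>A i\<close>
  behave like counts stored under indices; families with repeated sets are treated separately at the
  end.\<close>

locale weighted_family =
  fixes k :: nat and A :: "nat \<Rightarrow> 'a set" and w :: "'a \<Rightarrow> real"
  assumes inj_A: "inj_on A {1..k}"
    and inj_w: "inj_on w (\<Union>i\<in>{1..k}. A i)"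
begin

section \<open>The invariant of runs with arbitrary decisions\<close>

definition start :: "'a set \<Rightarrow> nat" where
  "start = restrict (\<lambda>_. 0) (A ` {1..k})"

text \<open>The last clause compares discarded elements with the original sets \<open>A i\<close>,
  not with the shrunken \<open>F i\<close>, because the parking conditions concern
  \<open>exactly_one J A\<close>. Extensionality makes the final counts a function on the collection
  of sets.\<close>

definition run_inv where
  "run_inv I F f R \<longleftrightarrow>
     I \<subseteq> {1..k} \<and> finite R \<and> f \<in> extensional (A ` {1..k}) \<and>
     (\<forall>i\<in>I. R \<inter> A i = {}) \<and>
     (\<forall>j\<in>{1..k}. F j \<subseteq> A j \<and> finite (A j - F j) \<and> f (A j) = card (A j - F j) \<and>
        (\<forall>i\<in>I. i \<noteq> j \<longrightarrow> A i \<inter> (A j - F j) = {}))"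

lemma A_eq_iff: "i \<in> {1..k} \<Longrightarrow> j \<in> {1..k} \<Longrightarrow> A i = A j \<longleftrightarrow> i = j"
  using inj_A by (auto dest: inj_onD)

lemma inv_start: "run_inv {1..k} A start {}"
  by (auto simp: run_inv_def start_def)

text \<open>Upgrades uniqueness among the current sets \<open>F j\<close> to uniqueness among the
  original \<open>A j\<close>: if \<open>e\<close> had been discarded from \<open>F j\<close>
  earlier, the invariant would keep it out of \<open>A s\<close>, as \<open>s\<close> is still
  active.\<close>

lemma chosen_unique:
  assumes "run_inv I F f R" "is_arg_min w (\<lambda>x. x \<in> exactly_one I F) e" "s \<in> I" "e \<in> F s"
  shows "s \<in> {1..k}" "e \<in> A s" "\<And>j. j \<in> I \<Longrightarrow> e \<in> A j \<Longrightarrow> j = s"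
proof -
  show s: "s \<in> {1..k}" and e: "e \<in> A s"
    using assms unfolding run_inv_def by blast+
  fix j assume j: "j \<in> I" "e \<in> A j"
  have "e \<in> exactly_one I F" using assms(2) by (simp add: is_arg_min_def)
  then have "e \<in> F j \<Longrightarrow> j = s" using assms(3,4) j by (auto simp: exactly_one_iff)
  moreover have "s \<noteq> j \<Longrightarrow> A s \<inter> (A j - F j) = {}"
    using assms(1,3) j(1) unfolding run_inv_def by (meson subsetD)
  ultimately show "j = s" using e j(2) by blast
qed

lemma inv_discard:
  assumes inv: "run_inv I F f R" and e: "is_arg_min w (\<lambda>x. x \<in> exactly_one I F) e" "s \<in> I" "e \<in> F s"
  shows "run_inv I (F(s := F s - {e})) (f(A s := f (A s) + 1)) R"
proof -
  note u = chosen_unique[OF inv e]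
  have eq: "A s - (F s - {e}) = insert e (A s - F s)" using u(2) by blast
  have s: "F s \<subseteq> A s" "finite (A s - F s)" "f (A s) = card (A s - F s)"
    "\<And>i. i \<in> I \<Longrightarrow> i \<noteq> s \<Longrightarrow> A i \<inter> (A s - F s) = {}"
    using inv u(1) unfolding run_inv_def by blast+
  let ?F = "F(s := F s - {e})" and ?f = "f(A s := f (A s) + 1)"
  have "?F j \<subseteq> A j \<and> finite (A j - ?F j) \<and> ?f (A j) = card (A j - ?F j) \<and>
        (\<forall>i\<in>I. i \<noteq> j \<longrightarrow> A i \<inter> (A j - ?F j) = {})" if j: "j \<in> {1..k}" for j
  proof (cases "j = s")
    case True
    have "A i \<inter> insert e (A s - F s) = {}" if "i \<in> I" "i \<noteq> s" for i
      using s(4)[OF that] u(3)[OF that(1)] that(2) by blast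
    then show ?thesis using s(1-3) e(3) True by (auto simp: eq)
  next
    case False
    \<comment> \<open>The update of \<open>f\<close> at the set \<open>A s\<close> must leave the
      count of \<open>j\<close> unchanged.\<close>
    then have "A j \<noteq> A s" using A_eq_iff j u(1) by blast
    then show ?thesis using False inv j unfolding run_inv_def by simp
  qed
  moreover have "?f \<in> extensional (A ` {1..k})"
    using inv u(1) by (auto simp: run_inv_def extensional_def)
  ultimately show ?thesis using inv unfolding run_inv_def by blast
qed

lemma inv_select:
  assumes inv: "run_inv I F f R" and e: "is_arg_min w (\<lambda>x. x \<in> exactly_one I F) e" "s \<in> I" "e \<in> F s"
  shows "run_inv (I - {s}) F f (insert e R)"
proof -
  have "insert e R \<inter> A i = {}" if "i \<in> I - {s}" for i
    using that chosen_unique(3)[OF inv e, of i] inv unfolding run_inv_def by blast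
  then show ?thesis using inv unfolding run_inv_def by blast
qed

lemma inv_free_step:
  assumes "free_step w A (I, F, f, R) (I', F', f', R')" "run_inv I F f R"
  shows "run_inv I' F' f' R'"
  using assms(1)
proof (cases rule: free_step.cases)
  case (free_discard e s)
  show ?thesis
    unfolding free_discard(1-4) using assms(2) free_discard(5-7) by (rule inv_discard)
next
  case (free_select e s)
  show ?thesis
    unfolding free_select(1-4) using assms(2) free_select(5-7) by (rule inv_select)
qed

lemma inv_free_run:
  assumes "(free_step w A)\<^sup>*\<^sup>* (I, F, f, R) (I', F', f', R')" "run_inv I F f R"
  shows "run_inv I' F' f' R'"
  using assms
proof (induction I' F' f' R' rule: rtranclp_induct4)
  case (step I1 F1 f1 R1 I2 F2 f2 R2)
  then show ?case using inv_free_step by blast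
qed

section \<open>Complete runs and what they produce\<close>

text \<open>Only elements still present in an active set can be selected later, each selection uses
  up one index, and the count of an inactive index is frozen. Decisions made midway can thus be
  recovered from the final \<open>D\<close> and \<open>f'\<close>.\<close>

lemma complete_run_bounds:
  assumes "(free_step w A)\<^sup>*\<^sup>* (I, F, f, R) ({}, F', f', D)" "run_inv I F f R"
  shows "R \<subseteq> D \<and> D \<subseteq> R \<union> (\<Union>j\<in>I. F j) \<and> card D = card R + card I \<and>
    (\<forall>j\<in>{1..k}. f (A j) \<le> f' (A j) \<and> (j \<notin> I \<longrightarrow> f' (A j) = f (A j)))"
  using assms
proof (induction I F f R rule: converse_rtranclp_induct4)
  case refl
  then show ?case by simp
next
  case (step I F f R I1 F1 f1 R1)
  note IH = step.IH[OF inv_free_step[OF step.hyps(1) step.prems]]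
  from step.hyps(1) show ?case
  proof (cases rule: free_step.cases)
    case (free_discard e s)
    note u = chosen_unique[OF step.prems free_discard(5-7)]
    have "f (A j) \<le> f1 (A j) \<and> (j \<notin> I \<longrightarrow> f1 (A j) = f (A j))" if "j \<in> {1..k}" for j
      using A_eq_iff[OF that u(1)] free_discard by auto
    moreover have "(\<Union>j\<in>I1. F1 j) \<subseteq> (\<Union>j\<in>I. F j)"
      using free_discard by (auto split: if_splits)
    ultimately show ?thesis using IH unfolding free_discard(1,4)
      by (intro conjI ballI) (blast, blast, blast, meson order_trans, metis)
  next
    case (free_select e s)
    \<comment> \<open>Earlier selections avoid every active set, in particular \<open>A s\<close>,
      so each selection adds a new element.\<close>
    have fin: "finite R" "finite I" "e \<notin> R"
      using step.prems chosen_unique(2)[OF step.prems free_select(5-7)] free_select(6)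
      unfolding run_inv_def by (auto intro: finite_subset)
    then have "card R1 + card I1 = card R + card I"
      using card_Suc_Diff1[OF fin(2) free_select(6)] by (simp add: free_select(1,4))
    moreover have "R1 \<union> (\<Union>j\<in>I1. F1 j) \<subseteq> R \<union> (\<Union>j\<in>I. F j)"
      using free_select(6,7) unfolding free_select(1,2,4) by blast
    moreover have "R \<subseteq> R1" unfolding free_select(4) by blast
    ultimately show ?thesis using IH unfolding free_select(1,3)
      by (intro conjI ballI) (blast, blast, metis, blast, blast)
  qed
qed

text \<open>The test of Algorithm A repeats every decision of the run: a selected element stays in
  \<open>D\<close>, and a discarded one can never enter \<open>D\<close> afterwards.\<close>

lemma complete_run_is_algA:
  assumes "(free_step w A)\<^sup>*\<^sup>* (I, F, f, R) ({}, F', f', D)" "run_inv I F f R"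
  shows "(algA_step w A D)\<^sup>*\<^sup>* (I, F, f) ({}, F', f')"
  using assms
proof (induction I F f R rule: converse_rtranclp_induct4)
  case refl
  then show ?case by simp
next
  case (step I F f R I1 F1 f1 R1)
  note inv1 = inv_free_step[OF step.hyps(1) step.prems]
  note b = complete_run_bounds[OF step.hyps(2) inv1]
  from step.hyps(1) have "algA_step w A D (I, F, f) (I1, F1, f1)"
  proof (cases rule: free_step.cases)
    case (free_discard e s)
    note u = chosen_unique[OF step.prems free_discard(5-7)]
    have "e \<notin> R" using u(2) free_discard(6) step.prems unfolding run_inv_def by blast
    \<comment> \<open>After removal from \<open>F s\<close>, the element \<open>e\<close> lies in no
      active set at all, so the upper bound on \<open>D\<close> excludes it.\<close>
    moreover have "e \<notin> F1 j" if "j \<in> I" for j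
    proof (cases "j = s")
      case False
      then have "e \<notin> A j" using u(3) that by blast
      then show ?thesis
        using that False step.prems free_discard(2) unfolding run_inv_def by auto
    qed (simp add: free_discard(2))
    ultimately have "e \<notin> D" using b free_discard(1,4) by blast
    with free_discard(5-7) show ?thesis
      unfolding free_discard(1-3) by (rule algA_step.discard)
  next
    case (free_select e s)
    then have "e \<in> D" using b by blast
    with free_select(5-7) show ?thesis
      unfolding free_select(1-3) by (rule algA_step.select)
  qed
  then show ?case using step.IH[OF inv1] by (rule converse_rtranclp_into_rtranclp)
qed

text \<open>Here \<open>g\<close> is the number of discards still to come. It is positive at a
  discard, because counts never decrease later, and zero at a selection, because the count of
  \<open>s\<close> is then final.\<close>

lemma complete_run_is_algB:
  assumes "(free_step w A)\<^sup>*\<^sup>* (I, F, f, R) ({}, F', f', D)" "run_inv I F f R"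
    and "\<forall>j\<in>{1..k}. f (A j) + g (A j) = f' (A j)"
  shows "\<exists>g'. (algB_step w A)\<^sup>*\<^sup>* (I, F, g, R) ({}, F', g', D)"
  using assms
proof (induction I F f R arbitrary: g rule: converse_rtranclp_induct4)
  case refl
  then show ?case by blast
next
  case (step I F f R I1 F1 f1 R1)
  note inv1 = inv_free_step[OF step.hyps(1) step.prems(1)]
  note b = complete_run_bounds[OF step.hyps(2) inv1]
  from step.hyps(1) have "\<exists>g1. algB_step w A (I, F, g, R) (I1, F1, g1, R1) \<and>
    (\<forall>j\<in>{1..k}. f1 (A j) + g1 (A j) = f' (A j))"
  proof (cases rule: free_step.cases)
    case (free_discard e s)
    note u = chosen_unique[OF step.prems(1) free_discard(5-7)]
    have "f1 (A s) \<le> f' (A s)" using b u(1) by blast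
    then have "g (A s) > 0" using free_discard(3) step.prems(2) u(1) by fastforce
    with free_discard(5-7)
    have "algB_step w A (I, F, g, R) (I1, F1, g(A s := g (A s) - 1), R1)"
      unfolding free_discard(1,2,4) by (rule algB_step.discard)
    moreover have "\<forall>j\<in>{1..k}. f1 (A j) + (g(A s := g (A s) - 1)) (A j) = f' (A j)"
      using step.prems(2) \<open>g (A s) > 0\<close> by (auto simp: free_discard(3))
    ultimately show ?thesis by blast
  next
    case (free_select e s)
    note u = chosen_unique[OF step.prems(1) free_select(5-7)]
    have "f' (A s) = f (A s)" using b u(1) free_select(1,3) by blast
    then have "\<not> g (A s) > 0" using step.prems(2) u(1) by fastforce
    with free_select(5-7) have "algB_step w A (I, F, g, R) (I1, F1, g, R1)"
      unfolding free_select(1,2,4) by (rule algB_step.keep)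
    then show ?thesis using step.prems(2) free_select(3) by blast
  qed
  then show ?case using step.IH[OF inv1] by (meson converse_rtranclp_into_rtranclp)
qed

lemma complete_run_parking:
  assumes "(free_step w A)\<^sup>*\<^sup>* (I, F, f, R) ({}, F', f', D)" "run_inv I F f R"
    and "J \<subseteq> I" "J \<noteq> {}"
  shows "D \<inter> exactly_one J A \<noteq> {} \<and>
    (\<exists>i\<in>J. infinite (A i \<inter> exactly_one J A) \<or> card (A i \<inter> exactly_one J A) > f' (A i))"
  using assms
proof (induction I F f R rule: converse_rtranclp_induct4)
  case refl
  then show ?case by blast
next
  case (step I F f R I1 F1 f1 R1)
  note inv1 = inv_free_step[OF step.hyps(1) step.prems(1)]
  note b = complete_run_bounds[OF step.hyps(2) inv1]
  show ?case
  proof (cases "J \<subseteq> I1")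
    case True
    then show ?thesis using step.IH[OF inv1] step.prems(3) by blast
  next
    case False
    from step.hyps(1) show ?thesis
    proof (cases rule: free_step.cases)
      \<comment> \<open>A discard leaves the active set unchanged, so the first loss of an index of
        \<open>J\<close> happens at a selection.\<close>
      case (free_discard e s)
      then show ?thesis using False step.prems(2) by blast
    next
      case (free_select e s)
      note u = chosen_unique[OF step.prems(1) free_select(5-7)]
      have sJ: "s \<in> J" using False step.prems(2) free_select(1) by blast
      have e: "e \<in> exactly_one J A"
        using sJ u step.prems(2) by (auto simp: exactly_one_iff)
      have "e \<in> D" using b free_select(4) by blast
      have inv: "finite (A s - F s)" "f (A s) = card (A s - F s)"
        "\<And>i. i \<in> I \<Longrightarrow> i \<noteq> s \<Longrightarrow> A i \<inter> (A s - F s) = {}"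
        using step.prems(1) u(1) unfolding run_inv_def by blast+
      have "A s - F s \<subseteq> exactly_one J A"
        using inv(3) sJ step.prems(2) unfolding exactly_one_iff subset_iff by blast
      then have sub: "insert e (A s - F s) \<subseteq> A s \<inter> exactly_one J A"
        using e u(2) by blast
      have "f' (A s) = f (A s)" using b u(1) free_select(1,3) by blast
      \<comment> \<open>The inequality is strict because \<open>e\<close> is still in
        \<open>F s\<close> and so is not among the counted discards.\<close>
      then have "f' (A s) < card (insert e (A s - F s))"
        using inv(1,2) free_select(7) by simp
      then have "infinite (A s \<inter> exactly_one J A) \<or> card (A s \<inter> exactly_one J A) > f' (A s)"
        using card_mono[OF _ sub] by fastforce
      then show ?thesis using sJ e \<open>e \<in> D\<close> by blast
    qed
  qed
qed

lemma complete_run: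
  assumes run: "(free_step w A)\<^sup>*\<^sup>* ({1..k}, A, start, {}) ({}, F, f, D)"
  shows "D \<in> S_parking_sets k A" "f \<in> S_parking_functions k A"
    "algA_output w k A D f" "algB_output w k A f D" "card D = k"
proof -
  note inv = inv_free_run[OF run inv_start]
  note park = complete_run_parking[OF run inv_start]
  have fin: "finite D" using inv by (simp add: run_inv_def)
  show card: "card D = k" using complete_run_bounds[OF run inv_start] by simp
  show "D \<in> S_parking_sets k A"
    using fin card park unfolding S_parking_sets_def by blast
  show "f \<in> S_parking_functions k A"
    using inv park unfolding S_parking_functions_def run_inv_def PiE_def by blast
  show "algA_output w k A D f"
    using complete_run_is_algA[OF run inv_start] unfolding algA_output_def start_def by blast
  show "algB_output w k A f D"
    \<comment> \<open>All counts start at zero, so the discards still to come are given by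
      \<open>f\<close> itself.\<close>
    using complete_run_is_algB[OF run inv_start, of f]
    unfolding algB_output_def by (simp add: start_def) blast
qed

section \<open>Runs of the two algorithms as free runs\<close>

text \<open>The inclusion \<open>R \<subseteq> D\<close> identifies the selected set at the end of a
  run; the fact that no element of \<open>D\<close> is discarded serves termination.\<close>

lemma algA_run_is_free_run:
  assumes "(algA_step w A D)\<^sup>*\<^sup>* ({1..k}, A, start) (I, F, f)"
  shows "\<exists>R. (free_step w A)\<^sup>*\<^sup>* ({1..k}, A, start, {}) (I, F, f, R) \<and> R \<subseteq> D \<and>
    (\<forall>j. (A j - F j) \<inter> D = {})"
  using assms
proof (induction I F f rule: rtranclp_induct3)
  case refl
  then show ?case by blast
next
  case (step I F f I1 F1 f1)
  then obtain R where R: "(free_step w A)\<^sup>*\<^sup>* ({1..k}, A, start, {}) (I, F, f, R)" "R \<subseteq> D"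
    "\<forall>j. (A j - F j) \<inter> D = {}" by blast
  from step.hyps(2) show ?case
  proof (cases rule: algA_step.cases)
    case (discard e s)
    have "free_step w A (I, F, f, R) (I1, F1, f1, R)"
      unfolding discard(1-3) using discard(4-6) by (rule free_discard)
    moreover have "\<forall>j. (A j - F1 j) \<inter> D = {}" using R(3) discard by auto
    ultimately show ?thesis using R by (meson rtranclp.rtrancl_into_rtrancl)
  next
    case (select e s)
    have "free_step w A (I, F, f, R) (I1, F1, f1, insert e R)"
      unfolding select(1-3) using select(4-6) by (rule free_select)
    then show ?thesis using R select
      by (intro exI[of _ "insert e R"]) (auto intro: rtranclp.rtrancl_into_rtrancl)
  qed
qed

text \<open>Discards move units from \<open>g\<close> to \<open>f\<close>, and an index leaves only
  when its \<open>g\<close> is exhausted. At the end the counts therefore equal \<open>f0\<close> on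
  every \<open>A j\<close>.\<close>

lemma algB_run_is_free_run:
  assumes "(algB_step w A)\<^sup>*\<^sup>* ({1..k}, A, f0, {}) (I, F, g, R)"
  shows "\<exists>f. (free_step w A)\<^sup>*\<^sup>* ({1..k}, A, start, {}) (I, F, f, R) \<and>
    (\<forall>j\<in>{1..k}. f (A j) + g (A j) = f0 (A j) \<and> (j \<notin> I \<longrightarrow> g (A j) = 0))"
  using assms
proof (induction I F g R rule: rtranclp_induct4)
  case refl
  then show ?case by (intro exI[of _ start]) (simp add: start_def)
next
  case (step I F g R I1 F1 g1 R1)
  then obtain f where f: "(free_step w A)\<^sup>*\<^sup>* ({1..k}, A, start, {}) (I, F, f, R)"
    "\<forall>j\<in>{1..k}. f (A j) + g (A j) = f0 (A j) \<and> (j \<notin> I \<longrightarrow> g (A j) = 0)" by blast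
  from step.hyps(2) show ?case
  proof (cases rule: algB_step.cases)
    case (discard e s)
    have "free_step w A (I, F, f, R) (I1, F1, f(A s := f (A s) + 1), R1)"
      unfolding discard(1,2,4) using discard(5-7) by (rule free_discard)
    moreover have "\<forall>j\<in>{1..k}. (f(A s := f (A s) + 1)) (A j) + g1 (A j) = f0 (A j) \<and>
        (j \<notin> I1 \<longrightarrow> g1 (A j) = 0)"
      using f(2) discard by auto
    ultimately show ?thesis using f(1) by (meson rtranclp.rtrancl_into_rtrancl)
  next
    case (keep e s)
    have "free_step w A (I, F, f, R) (I1, F1, f, R1)"
      unfolding keep(1,2,4) using keep(5-7) by (rule free_select)
    moreover have "\<forall>j\<in>{1..k}. f (A j) + g1 (A j) = f0 (A j) \<and> (j \<notin> I1 \<longrightarrow> g1 (A j) = 0)"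
      using f(2) keep by auto
    ultimately show ?thesis using f(1) by (meson rtranclp.rtrancl_into_rtrancl)
  qed
qed

lemma algA_output_correct:
  assumes "D \<in> S_parking_sets k A" "algA_output w k A D f"
  shows "f \<in> S_parking_functions k A" "algB_output w k A f D"
proof -
  obtain F R where R: "(free_step w A)\<^sup>*\<^sup>* ({1..k}, A, start, {}) ({}, F, f, R)" "R \<subseteq> D"
    using assms(2) algA_run_is_free_run unfolding algA_output_def start_def by blast
  note run = complete_run[OF R(1)]
  have "finite D" "card D = k" using assms(1) by (simp_all add: S_parking_sets_def)
  \<comment> \<open>A complete run selects exactly \<open>k\<close> elements, as many as
    \<open>D\<close> has.\<close>
  then have "R = D" using card_subset_eq[OF _ R(2)] run(5) by simp
  then show "f \<in> S_parking_functions k A" "algB_output w k A f D"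
    using run by blast+
qed

lemma algB_output_correct:
  assumes "f \<in> S_parking_functions k A" "algB_output w k A f D"
  shows "D \<in> S_parking_sets k A" "algA_output w k A D f"
proof -
  obtain F g where "(algB_step w A)\<^sup>*\<^sup>* ({1..k}, A, f, {}) ({}, F, g, D)"
    using assms(2) unfolding algB_output_def by blast
  from algB_run_is_free_run[OF this] obtain f' where
    f': "(free_step w A)\<^sup>*\<^sup>* ({1..k}, A, start, {}) ({}, F, f', D)"
    "\<forall>j\<in>{1..k}. f' (A j) = f (A j)"
    by (metis add.right_neutral empty_iff)
  have "f' \<in> extensional (A ` {1..k})"
    using inv_free_run[OF f'(1) inv_start] by (simp add: run_inv_def)
  moreover have "f \<in> extensional (A ` {1..k})"
    using assms(1) by (auto simp: S_parking_functions_def PiE_def)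
  ultimately have "f' = f"
    using f'(2) by (auto intro: extensionalityI)
  then show "D \<in> S_parking_sets k A" "algA_output w k A D f"
    using complete_run[OF f'(1)] by blast+
qed

section \<open>Uniqueness of the outputs\<close>

lemma choice_deterministic:
  assumes "I \<subseteq> {1..k}" "\<forall>j\<in>I. F j \<subseteq> A j"
    and "is_arg_min w (\<lambda>x. x \<in> exactly_one I F) e" "s \<in> I" "e \<in> F s"
    and "is_arg_min w (\<lambda>x. x \<in> exactly_one I F) e'" "s' \<in> I" "e' \<in> F s'"
  shows "e = e' \<and> s = s'"
proof -
  have "w e = w e'" using assms(3,6) by (force simp: is_arg_min_def)
  then have "e = e'" using inj_w assms by (auto dest!: inj_onD)
  moreover have "e \<in> exactly_one I F" using assms(3) by (simp add: is_arg_min_def)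
  ultimately show ?thesis using assms(4,5,7,8) unfolding exactly_one_iff by blast
qed

lemma algA_output_unique:
  assumes "algA_output w k A D f" "algA_output w k A D f'"
  shows "f = f'"
proof -
  \<comment> \<open>Keeps all candidates inside the union of the \<open>A j\<close>, where
    \<open>w\<close> is injective.\<close>
  let ?P = "\<lambda>(I, F, f :: 'a set \<Rightarrow> nat). I \<subseteq> {1..k} \<and> (\<forall>j\<in>I. F j \<subseteq> A j)"
  obtain F F' where runs: "(algA_step w A D)\<^sup>*\<^sup>* ({1..k}, A, start) ({}, F, f)"
    "(algA_step w A D)\<^sup>*\<^sup>* ({1..k}, A, start) ({}, F', f')"
    using assms unfolding algA_output_def start_def by blast
  have "({} :: nat set, F, f) = ({}, F', f')"
  proof (rule rtranclp_terminal_unique[OF runs, where P = ?P])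
    show "?P b" if "?P a" "algA_step w A D a b" for a b
      using that(2,1) by cases auto
    show "b = c" if P: "?P a" and b: "algA_step w A D a b" and c: "algA_step w A D a c" for a b c
      using b
    proof cases
      case (discard I F e s f)
      from c show ?thesis
      proof cases
        case (discard I' F' e' s' f')
        then show ?thesis using \<open>a = (I, F, f)\<close> P choice_deterministic[of I F e s e' s'] \<open>s \<in> I\<close>
            \<open>e \<in> F s\<close> \<open>is_arg_min w (\<lambda>x. x \<in> exactly_one I F) e\<close> \<open>b = _\<close> by auto
      next
        case (select I' F' e' s' f')
        then show ?thesis using discard P choice_deterministic[of I F e s e' s'] by auto
      qed
    next
      case (select I F e s f)
      from c show ?thesis
      proof cases
        case (discard I' F' e' s' f')
        then show ?thesis using select P choice_deterministic[of I F e s e' s'] by auto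
      next
        case (select I' F' e' s' f')
        then show ?thesis using \<open>a = (I, F, f)\<close> P choice_deterministic[of I F e s e' s'] \<open>s \<in> I\<close>
            \<open>e \<in> F s\<close> \<open>is_arg_min w (\<lambda>x. x \<in> exactly_one I F) e\<close> \<open>b = _\<close> by auto
      qed
    qed
  qed (auto elim: algA_step.cases)
  then show ?thesis by simp
qed

lemma algB_output_unique:
  assumes "algB_output w k A f D" "algB_output w k A f D'"
  shows "D = D'"
proof -
  let ?P = "\<lambda>(I, F, g :: 'a set \<Rightarrow> nat, R :: 'a set). I \<subseteq> {1..k} \<and> (\<forall>j\<in>I. F j \<subseteq> A j)"
  obtain F F' g g' where runs: "(algB_step w A)\<^sup>*\<^sup>* ({1..k}, A, f, {}) ({}, F, g, D)"
    "(algB_step w A)\<^sup>*\<^sup>* ({1..k}, A, f, {}) ({}, F', g', D')"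
    using assms unfolding algB_output_def by blast
  have "({} :: nat set, F, g, D) = ({}, F', g', D')"
  proof (rule rtranclp_terminal_unique[OF runs, where P = ?P])
    show "?P b" if "?P a" "algB_step w A a b" for a b
      using that(2,1) by cases auto
    show "b = c" if P: "?P a" and b: "algB_step w A a b" and c: "algB_step w A a c" for a b c
      using b
    proof cases
      case (discard I F e s g R)
      from c show ?thesis
      proof cases
        case (discard I' F' e' s' g' R')
        then show ?thesis using \<open>a = (I, F, g, R)\<close> P choice_deterministic[of I F e s e' s']
            \<open>s \<in> I\<close> \<open>e \<in> F s\<close> \<open>is_arg_min w (\<lambda>x. x \<in> exactly_one I F) e\<close> \<open>b = _\<close> by auto
      next
        case (keep I' F' e' s' g' R')
        then show ?thesis using discard P choice_deterministic[of I F e s e' s'] by auto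
      qed
    next
      case (keep I F e s g R)
      from c show ?thesis
      proof cases
        case (discard I' F' e' s' g' R')
        then show ?thesis using keep P choice_deterministic[of I F e s e' s'] by auto
      next
        case (keep I' F' e' s' g' R')
        then show ?thesis using \<open>a = (I, F, g, R)\<close> P choice_deterministic[of I F e s e' s']
            \<open>s \<in> I\<close> \<open>e \<in> F s\<close> \<open>is_arg_min w (\<lambda>x. x \<in> exactly_one I F) e\<close> \<open>b = _\<close> by auto
      qed
    qed
  qed (auto elim: algB_step.cases)
  then show ?thesis by simp
qed

section \<open>Termination when initial weight segments are finite\<close>

text \<open>Since the sets only shrink, \<open>x\<close> can stop being a candidate only by removal
  from its own set. This shows that a candidate exists.\<close>

lemma exactly_one_remaining:
  assumes "run_inv I F f R" "x \<in> exactly_one I A" "i \<in> I" "x \<in> F i"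
  shows "x \<in> exactly_one I F"
proof -
  have "F j \<subseteq> A j" if "j \<in> I" for j
    using assms(1) that unfolding run_inv_def by blast
  then show ?thesis using assms(2-4) unfolding exactly_one_iff by blast
qed

text \<open>The parking condition supplies some \<open>d\<close> in \<open>D\<close> that belongs to
  exactly one active set and is never discarded. The minimum thus exists and weighs at most
  \<open>w d\<close>.\<close>

lemma algA_terminates:
  assumes fin: "\<forall>x \<in> (\<Union>i\<in>{1..k}. A i). finite {y \<in> (\<Union>i\<in>{1..k}. A i). w y \<le> w x}"
    and D: "D \<in> S_parking_sets k A"
  shows "\<exists>f. algA_output w k A D f"
proof -
  let ?U = "\<Union>i\<in>{1..k}. A i"
  \<comment> \<open>A finite set containing every element the algorithm can choose. Each discard
    shrinks some \<open>F j \<inter> B\<close>, which gives the measure \<open>m\<close>.\<close>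
  define B where "B = (\<Union>d\<in>D \<inter> ?U. {y \<in> ?U. w y \<le> w d})"
  have finB: "finite B" using fin D unfolding B_def S_parking_sets_def by blast
  define m where "m = (\<lambda>(I :: nat set, F, f :: 'a set \<Rightarrow> nat).
    (\<Sum>j\<in>{1..k}. card (F j \<inter> B)) + card I)"
  let ?P = "\<lambda>S. (algA_step w A D)\<^sup>*\<^sup>* ({1..k}, A, start) S"
  have "\<exists>b. algA_step w A D a b \<and> ?P b \<and> m b < m a" if P: "?P a" and T: "fst a \<noteq> {}" for a
  proof -
    obtain I F f where a: "a = (I, F, f)" by (cases a)
    obtain R where R: "(free_step w A)\<^sup>*\<^sup>* ({1..k}, A, start, {}) (I, F, f, R)"
      "\<forall>j. (A j - F j) \<inter> D = {}"
      using algA_run_is_free_run P a by blast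
    note inv = inv_free_run[OF R(1) inv_start]
    have I: "I \<subseteq> {1..k}" "I \<noteq> {}" and FA: "\<And>j. j \<in> {1..k} \<Longrightarrow> F j \<subseteq> A j"
      using inv T a unfolding run_inv_def by auto
    then obtain d where d: "d \<in> D" "d \<in> exactly_one I A"
      using D unfolding S_parking_sets_def by blast
    then obtain i where i: "i \<in> I" "d \<in> A i" by (auto simp: exactly_one_iff)
    then have dF: "d \<in> exactly_one I F"
      using exactly_one_remaining[OF inv d(2) i(1)] R(2) d(1) by blast
    have sub: "exactly_one I F \<subseteq> ?U"
      using I(1) FA unfolding exactly_one_def by blast
    have "finite {y \<in> exactly_one I F. w y \<le> w d}"
      by (rule finite_subset[of _ "{y \<in> ?U. w y \<le> w d}"]) (use fin sub dF in auto)
    with dF obtain e where e: "is_arg_min w (\<lambda>x. x \<in> exactly_one I F) e" "w e \<le> w d"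
      by (rule is_arg_min_ex_below)
    then obtain s where s: "s \<in> I" "e \<in> F s"
      by (auto simp: is_arg_min_def exactly_one_iff)
    have "e \<in> ?U" "d \<in> ?U"
      using sub dF e(1) by (auto simp: is_arg_min_def)
    then have "e \<in> B"
      using e(2) d(1) unfolding B_def by blast
    show ?thesis
    proof (cases "e \<in> D")
      case True
      then have "algA_step w A D a (I - {s}, F, f)"
        unfolding a using algA_step.select[OF e(1) s] by blast
      moreover have "card (I - {s}) < card I"
        using s(1) I(1) by (meson card_Diff1_less finite_atLeastAtMost finite_subset)
      ultimately show ?thesis using P unfolding m_def a
        by (intro exI[of _ "(I - {s}, F, f)"]) (auto intro: rtranclp.rtrancl_into_rtrancl)
    next
      case False
      let ?F = "F(s := F s - {e})" and ?f = "f(A s := f (A s) + 1)"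
      have "algA_step w A D a (I, ?F, ?f)"
        unfolding a using e(1) s False by (rule algA_step.discard)
      moreover have "(\<Sum>j\<in>{1..k}. card (?F j \<inter> B)) < (\<Sum>j\<in>{1..k}. card (F j \<inter> B))"
      proof (rule sum_strict_mono_ex1)
        show "\<forall>j\<in>{1..k}. card (?F j \<inter> B) \<le> card (F j \<inter> B)"
          using finB by (auto intro: card_mono)
        have "card (?F s \<inter> B) < card (F s \<inter> B)"
          using finB s(2) \<open>e \<in> B\<close> by (intro psubset_card_mono) auto
        then show "\<exists>j\<in>{1..k}. card (?F j \<inter> B) < card (F j \<inter> B)"
          using s(1) I(1) by blast
      qed simp
      ultimately show ?thesis using P unfolding m_def a
        by (intro exI[of _ "(I, ?F, ?f)"]) (auto intro: rtranclp.rtrancl_into_rtrancl)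
    qed
  qed
  then have "\<exists>y. (algA_step w A D)\<^sup>*\<^sup>* ({1..k}, A, start) y \<and> fst y = {}"
    by (intro rtranclp_reaches_terminal[where P = ?P and m = m]) auto
  then show ?thesis unfolding algA_output_def start_def by force
qed

text \<open>Every step uses up a unit of \<open>g\<close> or an index. The parking inequality
  prevents getting stuck: at most \<open>f0 (A i)\<close> elements have left \<open>F i\<close>, so
  a candidate remains there.\<close>

lemma algB_terminates:
  assumes fin: "\<forall>x \<in> (\<Union>i\<in>{1..k}. A i). finite {y \<in> (\<Union>i\<in>{1..k}. A i). w y \<le> w x}"
    and f0: "f0 \<in> S_parking_functions k A"
  shows "\<exists>D. algB_output w k A f0 D"
proof -
  let ?U = "\<Union>i\<in>{1..k}. A i"
  define m where "m = (\<lambda>(I :: nat set, F :: nat \<Rightarrow> 'a set, g, R :: 'a set).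
    (\<Sum>j\<in>{1..k}. g (A j)) + card I)"
  let ?P = "\<lambda>S. (algB_step w A)\<^sup>*\<^sup>* ({1..k}, A, f0, {}) S"
  have "\<exists>b. algB_step w A a b \<and> ?P b \<and> m b < m a" if P: "?P a" and T: "fst a \<noteq> {}" for a
  proof -
    obtain I F g R where a: "a = (I, F, g, R)" by (cases a)
    obtain f where f: "(free_step w A)\<^sup>*\<^sup>* ({1..k}, A, start, {}) (I, F, f, R)"
      "\<forall>j\<in>{1..k}. f (A j) + g (A j) = f0 (A j)"
      using algB_run_is_free_run P a by blast
    note inv = inv_free_run[OF f(1) inv_start]
    have I: "I \<subseteq> {1..k}" "I \<noteq> {}" and FA: "\<And>j. j \<in> {1..k} \<Longrightarrow> F j \<subseteq> A j"
      using inv T a unfolding run_inv_def by auto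
    then obtain i where i: "i \<in> I" "infinite (A i \<inter> exactly_one I A) \<or>
        card (A i \<inter> exactly_one I A) > f0 (A i)"
      using f0 unfolding S_parking_functions_def by blast
    have disc: "finite (A i - F i)" "f (A i) = card (A i - F i)"
      using inv i(1) unfolding run_inv_def by blast+
    have "f (A i) \<le> f0 (A i)" using f(2) i(1) I(1) by (metis le_add1 subsetD)
    \<comment> \<open>Inclusion would make the intersection finite with at most
      \<open>f0 (A i)\<close> elements, against both alternatives for \<open>i\<close>.\<close>
    then have "\<not> A i \<inter> exactly_one I A \<subseteq> A i - F i"
      using disc i(2) by (metis card_mono finite_subset le_trans linorder_not_le)
    then obtain d where d: "d \<in> exactly_one I A" "d \<in> F i" by blast
    then have dF: "d \<in> exactly_one I F"
      using exactly_one_remaining[OF inv d(1) i(1)] by blast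
    have sub: "exactly_one I F \<subseteq> ?U"
      using I(1) FA unfolding exactly_one_def by blast
    have "finite {y \<in> exactly_one I F. w y \<le> w d}"
      by (rule finite_subset[of _ "{y \<in> ?U. w y \<le> w d}"]) (use fin sub dF in auto)
    with dF obtain e where e: "is_arg_min w (\<lambda>x. x \<in> exactly_one I F) e"
      by (rule is_arg_min_ex_below)
    then obtain s where s: "s \<in> I" "e \<in> F s"
      by (auto simp: is_arg_min_def exactly_one_iff)
    show ?thesis
    proof (cases "g (A s) > 0")
      case False
      then have "algB_step w A a (I - {s}, F, g, insert e R)"
        unfolding a using algB_step.keep[OF e s] by blast
      moreover have "card (I - {s}) < card I"
        using s(1) I(1) by (meson card_Diff1_less finite_atLeastAtMost finite_subset)
      ultimately show ?thesis using P unfolding m_def a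
        by (intro exI[of _ "(I - {s}, F, g, insert e R)"])
          (auto intro: rtranclp.rtrancl_into_rtrancl)
    next
      case True
      let ?F = "F(s := F s - {e})" and ?g = "g(A s := g (A s) - 1)"
      have "algB_step w A a (I, ?F, ?g, R)"
        unfolding a using e s True by (rule algB_step.discard)
      moreover have "(\<Sum>j\<in>{1..k}. ?g (A j)) < (\<Sum>j\<in>{1..k}. g (A j))"
        using True s(1) I(1) by (intro sum_strict_mono_ex1) auto
      ultimately show ?thesis using P unfolding m_def a
        by (intro exI[of _ "(I, ?F, ?g, R)"]) (auto intro: rtranclp.rtrancl_into_rtrancl)
    qed
  qed
  then have "\<exists>y. (algB_step w A)\<^sup>*\<^sup>* ({1..k}, A, f0, {}) y \<and> fst y = {}"
    by (intro rtranclp_reaches_terminal[where P = ?P and m = m]) auto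
  then show ?thesis unfolding algB_output_def by force
qed

section \<open>The bijections, including families with repeated sets\<close>

text \<open>An output of one algorithm on a valid input is a valid input of the other, which returns
  the original one. Each map is thus a two-sided inverse of the other.\<close>

lemma rho_sigma_bij:
  assumes "algorithms_define_maps w k A"
  shows "bij_betw (rho w k A) (S_parking_sets k A) (S_parking_functions k A) \<and>
         bij_betw (sigma w k A) (S_parking_functions k A) (S_parking_sets k A)"
proof -
  have rho: "rho w k A D = f" if "algA_output w k A D f" for D f
    unfolding rho_def using that algA_output_unique[OF _ that] by (rule the_equality)
  have sigma: "sigma w k A f = D" if "algB_output w k A f D" for D f
    unfolding sigma_def using that algB_output_unique[OF _ that] by (rule the_equality)
  have 1: "rho w k A D \<in> S_parking_functions k A \<and> sigma w k A (rho w k A D) = D"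
    if D: "D \<in> S_parking_sets k A" for D
  proof -
    obtain f where f: "algA_output w k A D f"
      using assms D unfolding algorithms_define_maps_def by blast
    show ?thesis using algA_output_correct[OF D f] rho[OF f] sigma by simp
  qed
  have 2: "sigma w k A f \<in> S_parking_sets k A \<and> rho w k A (sigma w k A f) = f"
    if f: "f \<in> S_parking_functions k A" for f
  proof -
    obtain D where D: "algB_output w k A f D"
      using assms f unfolding algorithms_define_maps_def by blast
    show ?thesis using algB_output_correct[OF f D] sigma[OF D] rho by simp
  qed
  show ?thesis
    using 1 2 bij_betw_byWitness[where f = "rho w k A" and f' = "sigma w k A"]
      bij_betw_byWitness[where f = "sigma w k A" and f' = "rho w k A"]
    by (simp add: image_subset_iff)
qed

end

text \<open>For two indices with equal sets, no element belongs to exactly one of them, so this pair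
  violates both parking conditions.\<close>

lemma parking_empty_if_not_inj:
  assumes "\<not> inj_on A {1..k}"
  shows "S_parking_sets k A = {}" "S_parking_functions k A = {}"
proof -
  obtain i j where ij: "i \<in> {1..k}" "j \<in> {1..k}" "i \<noteq> j" "A i = A j"
    using assms unfolding inj_on_def by blast
  then have "exactly_one {i, j} A = {}" by (auto simp: exactly_one_iff)
  moreover have "{i, j} \<subseteq> {1..k}" "{i, j} \<noteq> {}" using ij by auto
  ultimately obtain J where J: "J \<subseteq> {1..k} \<and> J \<noteq> {}" "exactly_one J A = {}" by blast
  show "S_parking_sets k A = {}" using J unfolding S_parking_sets_def by auto
  have False if "f \<in> S_parking_functions k A" for f
  proof -
    have "\<exists>i\<in>J. infinite (A i \<inter> exactly_one J A) \<or> card (A i \<inter> exactly_one J A) > f (A i)"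
      using that J(1) unfolding S_parking_functions_def by blast
    then show False using J(2) by simp
  qed
  then show "S_parking_functions k A = {}" by blast
qed

theorem theorem3p3:
  fixes k :: nat and A :: "nat \<Rightarrow> 'a set" and w :: "'a \<Rightarrow> real"
  assumes "k \<ge> 1"
    and "inj_on w (\<Union>i\<in>{1..k}. A i)"
    and "(\<forall>x \<in> (\<Union>i\<in>{1..k}. A i). finite {y \<in> (\<Union>i\<in>{1..k}. A i). w y \<le> w x})
         \<or> algorithms_define_maps w k A"
  shows "bij_betw (rho w k A) (S_parking_sets k A) (S_parking_functions k A) \<and>
         bij_betw (sigma w k A) (S_parking_functions k A) (S_parking_sets k A)"
proof (cases "inj_on A {1..k}")
  case True
  then interpret weighted_family k A w
    by unfold_locales (use assms(2) in auto)
  \<comment> \<open>The finiteness alternative implies this one by the termination lemmas.\<close>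
  have "algorithms_define_maps w k A"
    using assms(3) algA_terminates algB_terminates unfolding algorithms_define_maps_def by blast
  then show ?thesis by (rule rho_sigma_bij)
next
  case False
  \<comment> \<open>Both sides are empty, so any map is a bijection between them.\<close>
  then show ?thesis by (simp add: parking_empty_if_not_inj bij_betw_def)
qed

end
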